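(* Let $m\ge 1$ and $n>1$ be integers. The quantities $\mathrm{cat}_m(A,\kappa_1)$, $\mathrm{cat}_m(h;\kappa_1,\lambda_1)$, $\mathrm{TC}^m(A,\kappa_1)$, $\mathrm{TC}^m(h;\kappa_1,\lambda_1)$ and $n\text{-}\mathrm{TC}^m(A,\kappa_1)$ are digitally homotopy invariant, that is: (1) If $(A,\kappa_1)$ and $(A',\kappa_1')$ are digitally connected digital images and there is a digital homotopy equivalence between them, then $\mathrm{cat}_m(A,\kappa_1)=\mathrm{cat}_m(A',\kappa_1')$, $\mathrm{TC}^m(A,\kappa_1)=\mathrm{TC}^m(A',\kappa_1')$ and $n\text{-}\mathrm{TC}^m(A,\kappa_1)=n\text{-}\mathrm{TC}^m(A',\kappa_1')$. (2) If $h:(A,\kappa_1)\to(B,\lambda_1)$ and $k:(A',\kappa_1')\to(B',\lambda_1')$ are digitally continuous and there are digital homotopy equivalences $\omega_1:B\to B'$ and $\omega_2:A'\to A$ with $\omega_1\circ h\circ\omega_2\simeq_{\kappa_1',\lambda_1'}k$, then $\mathrm{cat}_m(h;\kappa_1,\lambda_1)=\mathrm{cat}_m(k;\kappa_1',\lambda_1')$; and if moreover $h$ and $k$ are digital fibrations, then $\mathrm{TC}^m(h;\kappa_1,\lambda_1)=\mathrm{TC}^m(k;\kappa_1',\lambda_1')$.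
   Context: Digital images: a digital image is a pair $(A,\kappa)$ with $A\subseteq\mathbb{Z}^r$ and $\kappa$ an adjacency relation on $A$; the basic ones are $c_p$ ($1\le p\le r$), where distinct $a,a'\in\mathbb{Z}^r$ are $c_p$-adjacent iff there are at most $p$ indices $i$ with $|a_i-a'_i|=1$ and $a_i=a'_i$ for all other $i$. Subsets carry the restricted adjacency. $a\leftrightarrow_\kappa a'$ means adjacent. A map $h:(A,\kappa)\to(A',\lambda)$ is digitally $(\kappa,\lambda)$-continuous if $a\leftrightarrow_\kappa a'$ implies that $h(a)=h(a')$ or $h(a)\leftrightarrow_\lambda h(a')$. On a product of digital images, the adjacency $\mathrm{NP}$ (normal/strong product) declares two distinct points adjacent iff in each coordinate they are equal or adjacent. $(A,\kappa)$ is $\kappa$-connected if any two points are joined by a finite sequence $b_0,\dots,b_l$ in $A$ with $b_i=b_{i+1}$ or $b_i\leftrightarrow_\kappa b_{i+1}$ for each $i$. Homotopy: $[0,z]_{\mathbb{Z}}=\{0,1,\dots,z\}$ carries the adjacency $2=c_1$ of $\mathbb{Z}$. Digitally continuous $h,k:(A,\kappa)\to(A',\lambda)$ are digitally homotopic, $h\simeq_{\kappa,\lambda}k$, if for some $z$ there is a digitally continuous $K:(A\times[0,z]_{\mathbb{Z}},\mathrm{NP}(\kappa,2))\to(A',\lambda)$ with $K(a,0)=h(a)$, $K(a,z)=k(a)$ for all $a$. A map is digitally nullhomotopic if it is digitally homotopic to a constant map. A digitally continuous $h:A\to A'$ is a digital homotopy equivalence if there is a digitally continuous $h':A'\to A$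 with $h\circ h'$ and $h'\circ h$ digitally homotopic to the identities. A digitally continuous $h:(A,\kappa_1)\to(A',\lambda_1)$ is a digital fibration if for every digital image $(B,\delta_1)$, every $z>0$, every digitally continuous $k:B\to A$ and every digital homotopy $K:(B\times[0,z]_{\mathbb{Z}},\mathrm{NP}(\delta_1,2))\to A'$ with $K(b,0)=h(k(b))$, there is a digitally continuous $\widetilde K:B\times[0,z]_{\mathbb{Z}}\to A$ with $h\circ\widetilde K=K$ and $\widetilde K(b,0)=k(b)$. Path space: $A^{[0,z]_{\mathbb{Z}}}$ is the set of digitally continuous maps $[0,z]_{\mathbb{Z}}\to A$, where $\vartheta,\theta$ are adjacent iff, whenever $t=t'$ or $t\leftrightarrow_2t'$, the points $\vartheta(t)$ and $\theta(t')$ are equal or adjacent in $A$. For $m>0$, an $m$-dimensional digital complex is a finite digital image $(P,\delta)$ with $P\subseteq\mathbb{Z}^m$. Each of the following is the least integer $q\ge0$ with the stated property ($\infty$ if none). $\mathrm{cat}_m(h;\kappa_1,\lambda_1)$, for digitally continuous $h:A\to A'$: $A=X_0\cup\dots\cup X_q$ such that for each $j$, every $m$-dimensional digital complex $(P,\delta)$ and every $(\delta,\kappa_1)$-continuous $\phi:P\to X_j$, the map $h|_{X_j}\circ\phi:P\to A'$ is digitally nullhomotopic. $\mathrm{cat}_m(A,\kappa_1)$: the same with $h=1_A$ (i.e. the inclusion $i_j:X_j\to A$ composed with $\phi$ is nullhomotopic in $A$). $\mathrm{TC}^m(A,\kappa_1)$, for $A$ connected: $A\times A=X_0\cup\dots\cup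 X_q$ such that for each $j$ there is a digitally continuous $s_j:X_j\to A^{[0,z]_{\mathbb{Z}}}$ (some $z$) such that $\pi\circ s_j\circ\phi$ is digitally homotopic to $\phi$ (as maps into $A\times A$ with $\mathrm{NP}(\kappa_1,\kappa_1)$) for every $m$-dimensional digital complex $P$ and every digitally continuous $\phi:P\to X_j$, where $\pi(\vartheta)=(\vartheta(0),\vartheta(z))$. $\mathrm{TC}^m(h;\kappa_1,\lambda_1)$, for a digital fibration $h:A\to A'$: $A\times A'=X_0\cup\dots\cup X_q$ such that for each $j$ there is a digitally continuous $s_j:X_j\to A^{[0,z]_{\mathbb{Z}}}$ (some $z$) such that $\pi_h\circ s_j\circ\phi$ is digitally homotopic to $\phi$ (as maps into $A\times A'$ with $\mathrm{NP}(\kappa_1,\lambda_1)$) for every $m$-dimensional digital complex $P$ and every digitally continuous $\phi:P\to X_j$, where $\pi_h(\vartheta)=(\vartheta(0),h(\vartheta(z)))$. $n\text{-}\mathrm{TC}^m(A,\kappa_1)=\mathrm{D}_m(pr_1,\dots,pr_n)$, for $A$ connected, with $pr_i:A^n\to A$ the projections ($A^n$ with NP adjacency), where for digitally continuous $h_1,\dots,h_n:(C,\kappa)\to(C',\lambda)$, $\mathrm{D}_m(h_1,\dots,h_n)$ is the least $q\ge 0$ such that $C=X_0\cup\dots\cup X_q$ where, for each $j$, every $m$-dimensional digital complex $(P,\delta)$ and every $(\delta,\kappa)$-continuous $\phi:P\to X_j$ satisfy $h_1\circ\phi\simeq_{\delta,\lambda}\cdots\simeq_{\delta,\lambda}h_n\circ\phi$.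 *)

theory Defs
  imports Main "HOL-Library.Extended_Nat" "HOL-Library.FuncSet"
begin

text \<open>Points of $\mathbb{Z}^r$ are integer lists of length $r$, so that images of all dimensions
  live in one type and can be quantified over. Adjacencies are predicates of which only
  the restriction to the image matters; likewise, maps are total functions considered only on
  their domain.\<close>

definition digital_image_in :: "nat \<Rightarrow> int list set \<Rightarrow> (int list \<Rightarrow> int list \<Rightarrow> bool) \<Rightarrow> bool" where
  "digital_image_in r A \<kappa> \<longleftrightarrow> A \<subseteq> {v. length v = r} \<and> irreflp_on A \<kappa> \<and> symp_on A \<kappa>"

definition digital_image :: "int list set \<Rightarrow> (int list \<Rightarrow> int list \<Rightarrow> bool) \<Rightarrow> bool" where
  "digital_image A \<kappa> \<longleftrightarrow> (\<exists>r\<ge>1. digital_image_in r A \<kappa>)"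

definition digital_complex :: "nat \<Rightarrow> int list set \<Rightarrow> (int list \<Rightarrow> int list \<Rightarrow> bool) \<Rightarrow> bool" where
  "digital_complex m P \<delta> \<longleftrightarrow> finite P \<and> digital_image_in m P \<delta>"

text \<open>The notions below are polymorphic in the type of points because they are also applied to
  products of images (encoded as sets of pairs or of extensional functions, rather than by
  concatenating coordinates) and to path spaces.\<close>

definition dcontinuous ::
  "'a set \<Rightarrow> ('a \<Rightarrow> 'a \<Rightarrow> bool) \<Rightarrow> 'b set \<Rightarrow> ('b \<Rightarrow> 'b \<Rightarrow> bool) \<Rightarrow> ('a \<Rightarrow> 'b) \<Rightarrow> bool" where
  "dcontinuous A \<kappa> B \<mu> h \<longleftrightarrow>
     h \<in> A \<rightarrow> B \<and> (\<forall>a\<in>A. \<forall>a'\<in>A. \<kappa> a a' \<longrightarrow> h a = h a' \<or> \<mu> (h a) (h a'))"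

definition dconnected :: "'a set \<Rightarrow> ('a \<Rightarrow> 'a \<Rightarrow> bool) \<Rightarrow> bool" where
  "dconnected A \<kappa> \<longleftrightarrow>
     (\<forall>a\<in>A. \<forall>a'\<in>A. \<exists>(l::nat) b. b 0 = a \<and> b l = a' \<and> (\<forall>i\<le>l. b i \<in> A) \<and>
        (\<forall>i<l. b i = b (Suc i) \<or> \<kappa> (b i) (b (Suc i))))"

definition NP ::
  "('a \<Rightarrow> 'a \<Rightarrow> bool) \<Rightarrow> ('b \<Rightarrow> 'b \<Rightarrow> bool) \<Rightarrow> 'a \<times> 'b \<Rightarrow> 'a \<times> 'b \<Rightarrow> bool" where
  "NP \<kappa> \<mu> p q \<longleftrightarrow> p \<noteq> q \<and>
     (fst p = fst q \<or> \<kappa> (fst p) (fst q)) \<and> (snd p = snd q \<or> \<mu> (snd p) (snd q))"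

definition NP_power :: "nat \<Rightarrow> ('a \<Rightarrow> 'a \<Rightarrow> bool) \<Rightarrow> (nat \<Rightarrow> 'a) \<Rightarrow> (nat \<Rightarrow> 'a) \<Rightarrow> bool" where
  "NP_power n \<kappa> x y \<longleftrightarrow> x \<noteq> y \<and> (\<forall>i\<in>{1..n}. x i = y i \<or> \<kappa> (x i) (y i))"

text \<open>The digital interval $[0,z]$ is the set \<open>{0..z}\<close> of natural numbers, with the
  $c_1$-adjacency of the integers.\<close>

definition adj2 :: "nat \<Rightarrow> nat \<Rightarrow> bool" where
  "adj2 s t \<longleftrightarrow> \<bar>int s - int t\<bar> = 1"

definition dhomotopy ::
  "'a set \<Rightarrow> ('a \<Rightarrow> 'a \<Rightarrow> bool) \<Rightarrow> 'b set \<Rightarrow> ('b \<Rightarrow> 'b \<Rightarrow> bool) \<Rightarrow> nat \<Rightarrow> ('a \<times> nat \<Rightarrow> 'b) \<Rightarrow> bool" where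
  "dhomotopy A \<kappa> B \<mu> z K \<longleftrightarrow> dcontinuous (A \<times> {0..z}) (NP \<kappa> adj2) B \<mu> K"

definition dhomotopic ::
  "'a set \<Rightarrow> ('a \<Rightarrow> 'a \<Rightarrow> bool) \<Rightarrow> 'b set \<Rightarrow> ('b \<Rightarrow> 'b \<Rightarrow> bool) \<Rightarrow> ('a \<Rightarrow> 'b) \<Rightarrow> ('a \<Rightarrow> 'b) \<Rightarrow> bool" where
  "dhomotopic A \<kappa> B \<mu> h k \<longleftrightarrow>
     dcontinuous A \<kappa> B \<mu> h \<and> dcontinuous A \<kappa> B \<mu> k \<and>
     (\<exists>z K. dhomotopy A \<kappa> B \<mu> z K \<and> (\<forall>a\<in>A. K (a, 0) = h a \<and> K (a, z) = k a))"

definition dnullhomotopic ::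
  "'a set \<Rightarrow> ('a \<Rightarrow> 'a \<Rightarrow> bool) \<Rightarrow> 'b set \<Rightarrow> ('b \<Rightarrow> 'b \<Rightarrow> bool) \<Rightarrow> ('a \<Rightarrow> 'b) \<Rightarrow> bool" where
  "dnullhomotopic A \<kappa> B \<mu> h \<longleftrightarrow> (\<exists>c\<in>B. dhomotopic A \<kappa> B \<mu> h (\<lambda>_. c))"

definition dhomotopy_equivalence ::
  "'a set \<Rightarrow> ('a \<Rightarrow> 'a \<Rightarrow> bool) \<Rightarrow> 'b set \<Rightarrow> ('b \<Rightarrow> 'b \<Rightarrow> bool) \<Rightarrow> ('a \<Rightarrow> 'b) \<Rightarrow> bool" where
  "dhomotopy_equivalence A \<kappa> B \<mu> h \<longleftrightarrow>
     dcontinuous A \<kappa> B \<mu> h \<and>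
     (\<exists>h'. dcontinuous B \<mu> A \<kappa> h' \<and>
        dhomotopic B \<mu> B \<mu> (h \<circ> h') id \<and> dhomotopic A \<kappa> A \<kappa> (h' \<circ> h) id)"

definition dfibration ::
  "'a set \<Rightarrow> ('a \<Rightarrow> 'a \<Rightarrow> bool) \<Rightarrow> 'b set \<Rightarrow> ('b \<Rightarrow> 'b \<Rightarrow> bool) \<Rightarrow> ('a \<Rightarrow> 'b) \<Rightarrow> bool" where
  "dfibration A \<kappa> A' \<mu> h \<longleftrightarrow>
     dcontinuous A \<kappa> A' \<mu> h \<and>
     (\<forall>B \<delta> z k K. digital_image B \<delta> \<and> z > 0 \<and> dcontinuous B \<delta> A \<kappa> k \<and>
        dhomotopy B \<delta> A' \<mu> z K \<and> (\<forall>b\<in>B. K (b, 0) = h (k b)) \<longrightarrow>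
        (\<exists>K'. dhomotopy B \<delta> A \<kappa> z K' \<and>
           (\<forall>b\<in>B. \<forall>t\<in>{0..z}. h (K' (b, t)) = K (b, t)) \<and> (\<forall>b\<in>B. K' (b, 0) = k b)))"

definition path_space :: "'a set \<Rightarrow> ('a \<Rightarrow> 'a \<Rightarrow> bool) \<Rightarrow> nat \<Rightarrow> (nat \<Rightarrow> 'a) set" where
  "path_space A \<kappa> z = {\<theta> \<in> {0..z} \<rightarrow>\<^sub>E A. dcontinuous {0..z} adj2 A \<kappa> \<theta>}"

text \<open>Distinctness of the two paths is not required; this makes no
  difference for continuity of maps into the path space.\<close>

definition path_adj :: "('a \<Rightarrow> 'a \<Rightarrow> bool) \<Rightarrow> nat \<Rightarrow> (nat \<Rightarrow> 'a) \<Rightarrow> (nat \<Rightarrow> 'a) \<Rightarrow> bool" where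
  "path_adj \<kappa> z \<theta> \<theta>' \<longleftrightarrow>
     (\<forall>t\<in>{0..z}. \<forall>t'\<in>{0..z}. t = t' \<or> adj2 t t' \<longrightarrow> \<theta> t = \<theta>' t' \<or> \<kappa> (\<theta> t) (\<theta>' t'))"

definition least_or_infinity :: "(nat \<Rightarrow> bool) \<Rightarrow> enat" where
  "least_or_infinity Q = (if \<exists>q. Q q then enat (LEAST q. Q q) else \<infinity>)"

definition cat_map ::
  "nat \<Rightarrow> 'a set \<Rightarrow> ('a \<Rightarrow> 'a \<Rightarrow> bool) \<Rightarrow> 'b set \<Rightarrow> ('b \<Rightarrow> 'b \<Rightarrow> bool) \<Rightarrow> ('a \<Rightarrow> 'b) \<Rightarrow> enat" where
  "cat_map m A \<kappa> B \<mu> h = least_or_infinity (\<lambda>q. \<exists>X. A = (\<Union>j\<le>q. X j) \<and>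
     (\<forall>j\<le>q. \<forall>P \<delta> \<phi>. digital_complex m P \<delta> \<and> dcontinuous P \<delta> (X j) \<kappa> \<phi> \<longrightarrow>
        dnullhomotopic P \<delta> B \<mu> (h \<circ> \<phi>)))"

definition cat :: "nat \<Rightarrow> 'a set \<Rightarrow> ('a \<Rightarrow> 'a \<Rightarrow> bool) \<Rightarrow> enat" where
  "cat m A \<kappa> = cat_map m A \<kappa> A \<kappa> id"

definition TC :: "nat \<Rightarrow> 'a set \<Rightarrow> ('a \<Rightarrow> 'a \<Rightarrow> bool) \<Rightarrow> enat" where
  "TC m A \<kappa> = least_or_infinity (\<lambda>q. \<exists>X. A \<times> A = (\<Union>j\<le>q. X j) \<and>
     (\<forall>j\<le>q. \<exists>z s. dcontinuous (X j) (NP \<kappa> \<kappa>) (path_space A \<kappa> z) (path_adj \<kappa> z) s \<and>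
        (\<forall>P \<delta> \<phi>. digital_complex m P \<delta> \<and> dcontinuous P \<delta> (X j) (NP \<kappa> \<kappa>) \<phi> \<longrightarrow>
           dhomotopic P \<delta> (A \<times> A) (NP \<kappa> \<kappa>) ((\<lambda>\<theta>. (\<theta> 0, \<theta> z)) \<circ> s \<circ> \<phi>) \<phi>)))"

definition TC_map ::
  "nat \<Rightarrow> 'a set \<Rightarrow> ('a \<Rightarrow> 'a \<Rightarrow> bool) \<Rightarrow> 'b set \<Rightarrow> ('b \<Rightarrow> 'b \<Rightarrow> bool) \<Rightarrow> ('a \<Rightarrow> 'b) \<Rightarrow> enat" where
  "TC_map m A \<kappa> B \<mu> h = least_or_infinity (\<lambda>q. \<exists>X. A \<times> B = (\<Union>j\<le>q. X j) \<and>
     (\<forall>j\<le>q. \<exists>z s. dcontinuous (X j) (NP \<kappa> \<mu>) (path_space A \<kappa> z) (path_adj \<kappa> z) s \<and>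
        (\<forall>P \<delta> \<phi>. digital_complex m P \<delta> \<and> dcontinuous P \<delta> (X j) (NP \<kappa> \<mu>) \<phi> \<longrightarrow>
           dhomotopic P \<delta> (A \<times> B) (NP \<kappa> \<mu>) ((\<lambda>\<theta>. (\<theta> 0, h (\<theta> z))) \<circ> s \<circ> \<phi>) \<phi>)))"

definition ddist ::
  "nat \<Rightarrow> 'a set \<Rightarrow> ('a \<Rightarrow> 'a \<Rightarrow> bool) \<Rightarrow> 'b set \<Rightarrow> ('b \<Rightarrow> 'b \<Rightarrow> bool) \<Rightarrow> nat \<Rightarrow> (nat \<Rightarrow> 'a \<Rightarrow> 'b) \<Rightarrow> enat" where
  "ddist m C \<kappa> C' \<mu> n h = least_or_infinity (\<lambda>q. \<exists>X. C = (\<Union>j\<le>q. X j) \<and>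
     (\<forall>j\<le>q. \<forall>P \<delta> \<phi>. digital_complex m P \<delta> \<and> dcontinuous P \<delta> (X j) \<kappa> \<phi> \<longrightarrow>
        (\<forall>i\<in>{1..<n}. dhomotopic P \<delta> C' \<mu> (h i \<circ> \<phi>) (h (Suc i) \<circ> \<phi>))))"

definition higher_TC :: "nat \<Rightarrow> nat \<Rightarrow> 'a set \<Rightarrow> ('a \<Rightarrow> 'a \<Rightarrow> bool) \<Rightarrow> enat" where
  "higher_TC n m A \<kappa> = ddist m ({1..n} \<rightarrow>\<^sub>E A) (NP_power n \<kappa>) A \<kappa> n (\<lambda>i x. x i)"

end

theory Submission
  imports Defs
begin

text \<open>Each quantity is monotone along pairs of continuous maps
  \<open>\<alpha> : A' \<rightarrow> A\<close> and \<open>\<beta> : B \<rightarrow> B'\<close> with \<open>\<beta> \<circ> h \<circ> \<alpha> \<simeq> k\<close>: a cover of the domain is pulled back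
  along \<open>\<alpha>\<close>, and the homotopies are pushed forward along \<open>\<beta>\<close>. For the topological complexity a section
  \<open>s\<close> over a piece is replaced by \<open>\<alpha>' \<circ> s \<circ> (\<alpha> \<times> \<beta>')\<close>, where \<open>\<alpha>'\<close> and \<open>\<beta>'\<close> are homotopy inverses.
  Equality follows since the relation between \<open>h\<close> and \<open>k\<close> is symmetric up to homotopy.\<close>

section \<open>Comparison of least values\<close>

text \<open>A weaker property is met no later, so the order reverses; if \<open>Q\<close> never
  holds, its value is infinity and bounds everything. Every inequality below thereby reduces to
  turning a cover indexed up to \<open>q\<close> into another one with the same
  \<open>q\<close>.\<close>

lemma least_or_infinity_mono:
  assumes "\<And>q. Q q \<Longrightarrow> R q"
  shows "least_or_infinity R \<le> least_or_infinity Q"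
proof (cases "\<exists>q. Q q")
  case True
  then have "R (LEAST q. Q q)"
    by (metis LeastI_ex assms)
  then show ?thesis
    using True by (auto simp: least_or_infinity_def intro: Least_le)
qed (simp add: least_or_infinity_def)

section \<open>Continuous maps and products\<close>

lemma dcontinuousI:
  assumes "\<And>a. a \<in> A \<Longrightarrow> h a \<in> B"
    and "\<And>a a'. a \<in> A \<Longrightarrow> a' \<in> A \<Longrightarrow> \<kappa> a a' \<Longrightarrow> h a = h a' \<or> \<mu> (h a) (h a')"
  shows "dcontinuous A \<kappa> B \<mu> h"
  using assms by (auto simp: dcontinuous_def)

lemma dcontinuous_in: "dcontinuous A \<kappa> B \<mu> h \<Longrightarrow> a \<in> A \<Longrightarrow> h a \<in> B"
  by (auto simp: dcontinuous_def)

text \<open>Hypothesis and conclusion both admit equality, so the output for one map is a valid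
  input for the next; this is what makes composition work.\<close>

lemma dcontinuous_adj:
  assumes "dcontinuous A \<kappa> B \<mu> h" "a \<in> A" "a' \<in> A" "a = a' \<or> \<kappa> a a'"
  shows "h a = h a' \<or> \<mu> (h a) (h a')"
  using assms unfolding dcontinuous_def by blast

lemma dcontinuous_id: "dcontinuous A \<kappa> A \<kappa> id"
  by (simp add: dcontinuous_def)

lemma dcontinuous_comp:
  assumes "dcontinuous A \<kappa> B \<mu> f" "dcontinuous B \<mu> C \<nu> g"
  shows "dcontinuous A \<kappa> C \<nu> (g \<circ> f)"
proof (rule dcontinuousI)
  fix a a' assume *: "a \<in> A" "a' \<in> A" "\<kappa> a a'"
  then have "f a = f a' \<or> \<mu> (f a) (f a')"
    by (intro dcontinuous_adj[OF assms(1)]) auto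
  then show "(g \<circ> f) a = (g \<circ> f) a' \<or> \<nu> ((g \<circ> f) a) ((g \<circ> f) a')"
    using dcontinuous_adj[OF assms(2)] dcontinuous_in[OF assms(1)] * by simp
qed (simp add: dcontinuous_in[OF assms(2)] dcontinuous_in[OF assms(1)])

text \<open>Since \<open>Y\<close> is only asked to contain the image of \<open>X\<close>, this
  serves both to narrow a codomain to a piece of a cover and to widen such a piece back to the whole
  image.\<close>

lemma dcontinuous_subset:
  assumes "dcontinuous A \<kappa> B \<mu> f" "X \<subseteq> A" "f ` X \<subseteq> Y"
  shows "dcontinuous X \<kappa> Y \<mu> f"
  using assms unfolding dcontinuous_def by blast

lemma dcontinuous_cong:
  assumes "dcontinuous A \<kappa> B \<mu> f" "\<And>a. a \<in> A \<Longrightarrow> f a = g a"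
  shows "dcontinuous A \<kappa> B \<mu> g"
  using assms(1) by (simp add: dcontinuous_def Pi_iff assms(2))

lemma eq_or_NP_iff:
  "p = q \<or> NP \<kappa> \<mu> p q \<longleftrightarrow>
     (fst p = fst q \<or> \<kappa> (fst p) (fst q)) \<and> (snd p = snd q \<or> \<mu> (snd p) (snd q))"
  by (auto simp: NP_def)

lemma dcontinuous_fst: "dcontinuous (A \<times> B) (NP \<kappa> \<mu>) A \<kappa> fst"
  by (auto simp: dcontinuous_def NP_def)

lemma dcontinuous_snd: "dcontinuous (A \<times> B) (NP \<kappa> \<mu>) B \<mu> snd"
  by (auto simp: dcontinuous_def NP_def)

lemma dcontinuous_Pair:
  assumes "dcontinuous C \<nu> A \<kappa> f" "dcontinuous C \<nu> B \<mu> g"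
  shows "dcontinuous C \<nu> (A \<times> B) (NP \<kappa> \<mu>) (\<lambda>c. (f c, g c))"
proof (rule dcontinuousI)
  fix c c' assume "c \<in> C" "c' \<in> C" "\<nu> c c'"
  then show "(f c, g c) = (f c', g c') \<or> NP \<kappa> \<mu> (f c, g c) (f c', g c')"
    using dcontinuous_adj[OF assms(1), of c c'] dcontinuous_adj[OF assms(2), of c c']
    by (simp only: eq_or_NP_iff fst_conv snd_conv) simp
qed (simp add: dcontinuous_in[OF assms(1)] dcontinuous_in[OF assms(2)])

lemma dcontinuous_map_prod:
  assumes "dcontinuous A \<kappa> A' \<kappa>' f" "dcontinuous B \<mu> B' \<mu>' g"
  shows "dcontinuous (A \<times> B) (NP \<kappa> \<mu>) (A' \<times> B') (NP \<kappa>' \<mu>') (map_prod f g)"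
proof -
  have "map_prod f g = (\<lambda>p. ((f \<circ> fst) p, (g \<circ> snd) p))"
    by auto
  then show ?thesis
    by (simp only:)
      (intro dcontinuous_Pair dcontinuous_comp[OF dcontinuous_fst] dcontinuous_comp[OF dcontinuous_snd] assms)
qed

section \<open>The calculus of homotopies\<close>

text \<open>Continuity of the two end maps comes for free, because they agree on \<open>A\<close>
  with time slices of \<open>K\<close>.\<close>

lemma dhomotopicI:
  assumes K: "dhomotopy A \<kappa> B \<mu> z K"
    and ends: "\<And>a. a \<in> A \<Longrightarrow> K (a, 0) = h a" "\<And>a. a \<in> A \<Longrightarrow> K (a, z) = k a"
  shows "dhomotopic A \<kappa> B \<mu> h k"
proof -
  \<comment> \<open>A slice is \<open>K\<close> after the inclusion of \<open>A\<close> at height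
    \<open>t\<close>, which is continuous because its second coordinate is constant.\<close>
  have slice: "dcontinuous A \<kappa> B \<mu> (\<lambda>a. K (a, t))" if "t \<le> z" for t
  proof -
    have "dcontinuous A \<kappa> (A \<times> {0..z}) (NP \<kappa> adj2) (\<lambda>a. (a, t))"
      using that by (intro dcontinuous_Pair) (auto simp: dcontinuous_def)
    from dcontinuous_comp[OF this K[unfolded dhomotopy_def]] show ?thesis
      by (simp add: o_def)
  qed
  have "dcontinuous A \<kappa> B \<mu> h" "dcontinuous A \<kappa> B \<mu> k"
    by (rule dcontinuous_cong[OF slice[of 0]] dcontinuous_cong[OF slice[of z]]; simp add: ends)+
  then show ?thesis
    using assms unfolding dhomotopic_def by blast
qed

lemma dhomotopicE:
  assumes "dhomotopic A \<kappa> B \<mu> h k"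
  obtains z K where "dhomotopy A \<kappa> B \<mu> z K"
    "\<And>a. a \<in> A \<Longrightarrow> K (a, 0) = h a" "\<And>a. a \<in> A \<Longrightarrow> K (a, z) = k a"
  using assms unfolding dhomotopic_def by blast

lemma dhomotopic_imp_dcontinuous:
  assumes "dhomotopic A \<kappa> B \<mu> h k"
  shows "dcontinuous A \<kappa> B \<mu> h" "dcontinuous A \<kappa> B \<mu> k"
  using assms by (auto simp: dhomotopic_def)

lemma dhomotopic_refl:
  assumes "dcontinuous A \<kappa> B \<mu> h"
  shows "dhomotopic A \<kappa> B \<mu> h h"
proof (rule dhomotopicI)
  \<comment> \<open>A homotopy may have length 0, where start and end coincide.\<close>
  show "dhomotopy A \<kappa> B \<mu> 0 (h \<circ> fst)"
    unfolding dhomotopy_def by (rule dcontinuous_comp[OF dcontinuous_fst assms])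
qed auto

lemma dhomotopic_sym:
  assumes "dhomotopic A \<kappa> B \<mu> h k"
  shows "dhomotopic A \<kappa> B \<mu> k h"
proof -
  obtain z K where K: "dhomotopy A \<kappa> B \<mu> z K"
    and ends: "\<And>a. a \<in> A \<Longrightarrow> K (a, 0) = h a" "\<And>a. a \<in> A \<Longrightarrow> K (a, z) = k a"
    using assms by (rule dhomotopicE) blast
  \<comment> \<open>Time is run backwards; truncated subtraction does no harm, as
    \<open>t \<le> z\<close> on the interval.\<close>
  have "dcontinuous {0..z} adj2 {0..z} adj2 (\<lambda>t. z - t)"
    by (auto simp: dcontinuous_def adj2_def)
  then have "dhomotopy A \<kappa> B \<mu> z (K \<circ> map_prod id (\<lambda>t. z - t))"
    using dcontinuous_comp[OF dcontinuous_map_prod[OF dcontinuous_id]] K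
    unfolding dhomotopy_def by blast
  then show ?thesis
    by (rule dhomotopicI) (use ends in auto)
qed

text \<open>The two homotopies are concatenated, the second one delayed by the length
  \<open>z\<close> of the first.\<close>

lemma dhomotopic_trans [trans]:
  assumes "dhomotopic A \<kappa> B \<mu> h k" "dhomotopic A \<kappa> B \<mu> k l"
  shows "dhomotopic A \<kappa> B \<mu> h l"
proof -
  obtain z K where K: "dhomotopy A \<kappa> B \<mu> z K"
    and K_ends: "\<And>a. a \<in> A \<Longrightarrow> K (a, 0) = h a" "\<And>a. a \<in> A \<Longrightarrow> K (a, z) = k a"
    using assms(1) by (rule dhomotopicE) blast
  obtain y L where L: "dhomotopy A \<kappa> B \<mu> y L"
    and L_ends: "\<And>a. a \<in> A \<Longrightarrow> L (a, 0) = k a" "\<And>a. a \<in> A \<Longrightarrow> L (a, y) = l a"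
    using assms(2) by (rule dhomotopicE) blast
  define M where "M = (\<lambda>(a, t). if t \<le> z then K (a, t) else L (a, t - z))"
  have M_left: "M (a, t) = K (a, t)" if "t \<le> z" for a t
    using that by (simp add: M_def)
  \<comment> \<open>At \<open>t = z\<close> the definition of \<open>M\<close> selects
    \<open>K\<close>, but \<open>K\<close> ends and \<open>L\<close> starts at \<open>k\<close>, so
    both formulas hold there.\<close>
  have M_right: "M (a, t) = L (a, t - z)" if "a \<in> A" "z \<le> t" for a t
    using that by (auto simp: M_def K_ends L_ends)
  have "dhomotopy A \<kappa> B \<mu> (z + y) M"
    unfolding dhomotopy_def
  proof (rule dcontinuousI; clarify)
    fix a t assume "a \<in> A" "t \<in> {0..z + y}"
    then show "M (a, t) \<in> B"
      using dcontinuous_in[OF K[unfolded dhomotopy_def], of "(a, t)"]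
        dcontinuous_in[OF L[unfolded dhomotopy_def], of "(a, t - z)"]
      by (cases "t \<le> z") (auto simp: M_left M_right)
  next
    fix a t a' t'
    assume *: "a \<in> A" "t \<in> {0..z + y}" "a' \<in> A" "t' \<in> {0..z + y}"
      and adj: "NP \<kappa> adj2 (a, t) (a', t')" and ne: "\<not> \<mu> (M (a, t)) (M (a', t'))"
    have t: "t = t' \<or> adj2 t t'" and a: "a = a' \<or> \<kappa> a a'"
      using adj by (auto simp: NP_def)
    \<comment> \<open>Times differ by at most 1 and the halves share the time \<open>z\<close>, so
      no adjacent pair straddles the seam.\<close>
    consider "t \<le> z" "t' \<le> z" | "z \<le> t" "z \<le> t'"
      using t unfolding adj2_def by linarith
    then show "M (a, t) = M (a', t')"
    proof cases
      case 1
      then show ?thesis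
        using dcontinuous_adj[OF K[unfolded dhomotopy_def], of "(a, t)" "(a', t')"] * adj ne
        by (auto simp: M_left)
    next
      case 2
      \<comment> \<open>With both times at least \<open>z\<close>, the shift is an honest
        subtraction and preserves adjacency.\<close>
      then have "(a, t - z) = (a', t' - z) \<or> NP \<kappa> adj2 (a, t - z) (a', t' - z)"
        unfolding eq_or_NP_iff using t a by (auto simp: adj2_def)
      then show ?thesis
        using dcontinuous_adj[OF L[unfolded dhomotopy_def], of "(a, t - z)" "(a', t' - z)"] * 2 ne
        by (auto simp: M_right)
    qed
  qed
  then show ?thesis
    by (rule dhomotopicI) (auto simp: M_left M_right K_ends L_ends)
qed

lemma dhomotopic_comp_left:
  assumes "dhomotopic A \<kappa> B \<mu> h k" "dcontinuous B \<mu> C \<nu> f"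
  shows "dhomotopic A \<kappa> C \<nu> (f \<circ> h) (f \<circ> k)"
proof -
  obtain z K where K: "dhomotopy A \<kappa> B \<mu> z K"
    and ends: "\<And>a. a \<in> A \<Longrightarrow> K (a, 0) = h a" "\<And>a. a \<in> A \<Longrightarrow> K (a, z) = k a"
    using assms(1) by (rule dhomotopicE) blast
  have "dhomotopy A \<kappa> C \<nu> z (f \<circ> K)"
    using K assms(2) unfolding dhomotopy_def by (rule dcontinuous_comp)
  then show ?thesis
    by (rule dhomotopicI) (use ends in auto)
qed

lemma dhomotopic_comp_right:
  assumes "dhomotopic A \<kappa> B \<mu> h k" "dcontinuous C \<nu> A \<kappa> f"
  shows "dhomotopic C \<nu> B \<mu> (h \<circ> f) (k \<circ> f)"
proof -
  obtain z K where K: "dhomotopy A \<kappa> B \<mu> z K"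
    and ends: "\<And>a. a \<in> A \<Longrightarrow> K (a, 0) = h a" "\<And>a. a \<in> A \<Longrightarrow> K (a, z) = k a"
    using assms(1) by (rule dhomotopicE) blast
  have "dhomotopy C \<nu> B \<mu> z (K \<circ> map_prod f id)"
    using dcontinuous_comp[OF dcontinuous_map_prod[OF assms(2) dcontinuous_id]] K
    unfolding dhomotopy_def by blast
  then show ?thesis
    by (rule dhomotopicI) (use ends dcontinuous_in[OF assms(2)] in auto)
qed

text \<open>The homotopies may have different lengths, so they run one after the other: first
  \<open>H\<close> with the second coordinate at rest at \<open>k\<close>, then \<open>K\<close>
  with the first at rest at \<open>h'\<close>.\<close>

lemma dhomotopic_Pair:
  assumes h: "dhomotopic C \<nu> A \<kappa> h h'" and k: "dhomotopic C \<nu> B \<mu> k k'"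
  shows "dhomotopic C \<nu> (A \<times> B) (NP \<kappa> \<mu>) (\<lambda>c. (h c, k c)) (\<lambda>c. (h' c, k' c))"
proof -
  obtain z H where H: "dhomotopy C \<nu> A \<kappa> z H"
    and H_ends: "\<And>c. c \<in> C \<Longrightarrow> H (c, 0) = h c" "\<And>c. c \<in> C \<Longrightarrow> H (c, z) = h' c"
    using h by (rule dhomotopicE) blast
  obtain y K where K: "dhomotopy C \<nu> B \<mu> y K"
    and K_ends: "\<And>c. c \<in> C \<Longrightarrow> K (c, 0) = k c" "\<And>c. c \<in> C \<Longrightarrow> K (c, y) = k' c"
    using k by (rule dhomotopicE) blast
  have "dhomotopy C \<nu> (A \<times> B) (NP \<kappa> \<mu>) z (\<lambda>p. (H p, (k \<circ> fst) p))"
    using H dhomotopic_imp_dcontinuous(1)[OF k] unfolding dhomotopy_def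
    by (intro dcontinuous_Pair dcontinuous_comp[OF dcontinuous_fst])
  then have "dhomotopic C \<nu> (A \<times> B) (NP \<kappa> \<mu>) (\<lambda>c. (h c, k c)) (\<lambda>c. (h' c, k c))"
    by (rule dhomotopicI) (auto simp: H_ends)
  also have "dhomotopy C \<nu> (A \<times> B) (NP \<kappa> \<mu>) y (\<lambda>p. ((h' \<circ> fst) p, K p))"
    using K dhomotopic_imp_dcontinuous(2)[OF h] unfolding dhomotopy_def
    by (intro dcontinuous_Pair dcontinuous_comp[OF dcontinuous_fst])
  then have "dhomotopic C \<nu> (A \<times> B) (NP \<kappa> \<mu>) (\<lambda>c. (h' c, k c)) (\<lambda>c. (h' c, k' c))"
    by (rule dhomotopicI) (auto simp: K_ends)
  finally show ?thesis .
qed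

section \<open>Path spaces\<close>

text \<open>This carries sections from one image to another. Paths are extensional functions, hence
  the restriction to the interval after composing with \<open>f\<close>.\<close>

lemma dcontinuous_path_map:
  assumes "dcontinuous A \<kappa> B \<mu> f"
  shows "dcontinuous (path_space A \<kappa> z) (path_adj \<kappa> z) (path_space B \<mu> z) (path_adj \<mu> z)
    (\<lambda>\<theta>. restrict (f \<circ> \<theta>) {0..z})"
proof (rule dcontinuousI)
  fix \<theta> assume "\<theta> \<in> path_space A \<kappa> z"
  then have "dcontinuous {0..z} adj2 B \<mu> (f \<circ> \<theta>)"
    unfolding path_space_def by (blast intro: dcontinuous_comp assms)
  then have "dcontinuous {0..z} adj2 B \<mu> (restrict (f \<circ> \<theta>) {0..z})"
    by (rule dcontinuous_cong) auto
  then show "restrict (f \<circ> \<theta>) {0..z} \<in> path_space B \<mu> z"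
    by (simp add: path_space_def PiE_def dcontinuous_def)
next
  fix \<theta> \<theta>'
  assume "\<theta> \<in> path_space A \<kappa> z" "\<theta>' \<in> path_space A \<kappa> z" "path_adj \<kappa> z \<theta> \<theta>'"
  then have "path_adj \<mu> z (restrict (f \<circ> \<theta>) {0..z}) (restrict (f \<circ> \<theta>') {0..z})"
    unfolding path_adj_def path_space_def
    using dcontinuous_adj[OF assms] by (simp add: PiE_iff)
  \<comment> \<open>The second disjunct always holds, since \<open>path_adj\<close> does not demand
    distinct paths.\<close>
  then show "restrict (f \<circ> \<theta>) {0..z} = restrict (f \<circ> \<theta>') {0..z} \<or>
      path_adj \<mu> z (restrict (f \<circ> \<theta>) {0..z}) (restrict (f \<circ> \<theta>') {0..z})" ..
qed

text \<open>This is the case of equal times in \<open>path_adj\<close>; it is applied below at the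
  times 0 and \<open>z\<close>.\<close>

lemma dcontinuous_path_eval:
  "t \<le> z \<Longrightarrow> dcontinuous (path_space A \<kappa> z) (path_adj \<kappa> z) A \<kappa> (\<lambda>\<theta>. \<theta> t)"
  by (auto simp: dcontinuous_def path_space_def path_adj_def)

section \<open>Monotonicity of category, topological complexity and homotopic distance\<close>

text \<open>If \<phi> maps into a pulled-back piece, then \<alpha> after \<phi> maps into a piece of
  the given cover. The resulting contraction is pushed forward by \<beta>, and the homotopy to
  \<open>k\<close> transfers it to \<open>k \<circ> \<phi>\<close>.\<close>

lemma cat_map_le:
  assumes \<alpha>: "dcontinuous A' \<kappa>' A \<kappa> \<alpha>" and \<beta>: "dcontinuous B \<mu> B' \<mu>' \<beta>"
    and k: "dhomotopic A' \<kappa>' B' \<mu>' (\<beta> \<circ> h \<circ> \<alpha>) k"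
  shows "cat_map m A' \<kappa>' B' \<mu>' k \<le> cat_map m A \<kappa> B \<mu> h"
  unfolding cat_map_def
proof (rule least_or_infinity_mono, elim exE conjE)
  fix q :: nat and X
  assume cover: "A = (\<Union>j\<le>q. X j)"
    and null: "\<forall>j\<le>q. \<forall>P \<delta> \<phi>. digital_complex m P \<delta> \<and> dcontinuous P \<delta> (X j) \<kappa> \<phi> \<longrightarrow>
      dnullhomotopic P \<delta> B \<mu> (h \<circ> \<phi>)"
  \<comment> \<open>The preimage is cut down to \<open>A'\<close> because \<alpha> is a total
    function, meaningful only there.\<close>
  define Y where "Y j = {a \<in> A'. \<alpha> a \<in> X j}" for j
  show "\<exists>Y. A' = (\<Union>j\<le>q. Y j) \<and> (\<forall>j\<le>q. \<forall>P \<delta> \<phi>.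
      digital_complex m P \<delta> \<and> dcontinuous P \<delta> (Y j) \<kappa>' \<phi> \<longrightarrow> dnullhomotopic P \<delta> B' \<mu>' (k \<circ> \<phi>))"
  proof (intro exI[of _ Y] conjI allI impI)
    show "A' = (\<Union>j\<le>q. Y j)"
      using dcontinuous_in[OF \<alpha>] cover by (auto simp: Y_def)
  next
    fix j P \<delta> \<phi>
    assume j: "j \<le> q" and "digital_complex m P \<delta> \<and> dcontinuous P \<delta> (Y j) \<kappa>' \<phi>"
    then have P: "digital_complex m P \<delta>" and \<phi>: "dcontinuous P \<delta> (Y j) \<kappa>' \<phi>"
      by auto
    have "dcontinuous (Y j) \<kappa>' (X j) \<kappa> \<alpha>"
      using \<alpha> by (rule dcontinuous_subset) (auto simp: Y_def)
    then have "dcontinuous P \<delta> (X j) \<kappa> (\<alpha> \<circ> \<phi>)"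
      by (rule dcontinuous_comp[OF \<phi>])
    then obtain c where c: "c \<in> B" "dhomotopic P \<delta> B \<mu> (h \<circ> (\<alpha> \<circ> \<phi>)) (\<lambda>_. c)"
      using null j P unfolding dnullhomotopic_def by blast
    have \<phi>': "dcontinuous P \<delta> A' \<kappa>' \<phi>"
      using \<phi> by (rule dcontinuous_subset) (use dcontinuous_in[OF \<phi>] in \<open>simp_all add: Y_def image_subset_iff\<close>)
    have "dhomotopic P \<delta> B' \<mu>' (k \<circ> \<phi>) (\<beta> \<circ> h \<circ> \<alpha> \<circ> \<phi>)"
      by (rule dhomotopic_sym[OF dhomotopic_comp_right[OF k \<phi>']])
    also have "dhomotopic P \<delta> B' \<mu>' (\<beta> \<circ> h \<circ> \<alpha> \<circ> \<phi>) (\<lambda>_. \<beta> c)"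
      using dhomotopic_comp_left[OF c(2) \<beta>] by (simp add: o_def)
    finally show "dnullhomotopic P \<delta> B' \<mu>' (k \<circ> \<phi>)"
      using dcontinuous_in[OF \<beta> c(1)] unfolding dnullhomotopic_def by blast
  qed
qed

text \<open>Pairs must travel from \<open>A' \<times> B'\<close> to \<open>A \<times> B\<close>,
  while paths must travel back from \<open>A\<close> to \<open>A'\<close>; this two-way traffic is
  why homotopy inverses enter, and the homotopies to the identities repair the endpoints
  afterwards.\<close>

lemma TC_map_le:
  assumes \<alpha>: "dcontinuous A' \<kappa>' A \<kappa> \<alpha>" and \<alpha>': "dcontinuous A \<kappa> A' \<kappa>' \<alpha>'"
    and \<alpha>\<alpha>': "dhomotopic A \<kappa> A \<kappa> (\<alpha> \<circ> \<alpha>') id" and \<alpha>'\<alpha>: "dhomotopic A' \<kappa>' A' \<kappa>' (\<alpha>' \<circ> \<alpha>) id"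
    and \<beta>: "dcontinuous B \<mu> B' \<mu>' \<beta>" and \<beta>': "dcontinuous B' \<mu>' B \<mu> \<beta>'"
    and \<beta>\<beta>': "dhomotopic B' \<mu>' B' \<mu>' (\<beta> \<circ> \<beta>') id"
    and h: "dcontinuous A \<kappa> B \<mu> h"
    and k: "dhomotopic A' \<kappa>' B' \<mu>' (\<beta> \<circ> h \<circ> \<alpha>) k"
  shows "TC_map m A' \<kappa>' B' \<mu>' k \<le> TC_map m A \<kappa> B \<mu> h"
  unfolding TC_map_def
proof (rule least_or_infinity_mono, elim exE conjE)
  fix q :: nat and X
  assume cover: "A \<times> B = (\<Union>j\<le>q. X j)"
    and sec: "\<forall>j\<le>q. \<exists>z s. dcontinuous (X j) (NP \<kappa> \<mu>) (path_space A \<kappa> z) (path_adj \<kappa> z) s \<and>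
        (\<forall>P \<delta> \<phi>. digital_complex m P \<delta> \<and> dcontinuous P \<delta> (X j) (NP \<kappa> \<mu>) \<phi> \<longrightarrow>
           dhomotopic P \<delta> (A \<times> B) (NP \<kappa> \<mu>) ((\<lambda>\<theta>. (\<theta> 0, h (\<theta> z))) \<circ> s \<circ> \<phi>) \<phi>)"
  \<comment> \<open>The second coordinate lies in \<open>B'\<close> and has to reach
    \<open>B\<close>, against the direction of \<beta>, so \<beta>' is used.\<close>
  define r where "r = map_prod \<alpha> \<beta>'"
  define Y where "Y j = {p \<in> A' \<times> B'. r p \<in> X j}" for j
  have r: "dcontinuous (A' \<times> B') (NP \<kappa>' \<mu>') (A \<times> B) (NP \<kappa> \<mu>) r"
    unfolding r_def by (rule dcontinuous_map_prod[OF \<alpha> \<beta>'])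
  show "\<exists>Y. A' \<times> B' = (\<Union>j\<le>q. Y j) \<and>
      (\<forall>j\<le>q. \<exists>z s. dcontinuous (Y j) (NP \<kappa>' \<mu>') (path_space A' \<kappa>' z) (path_adj \<kappa>' z) s \<and>
        (\<forall>P \<delta> \<phi>. digital_complex m P \<delta> \<and> dcontinuous P \<delta> (Y j) (NP \<kappa>' \<mu>') \<phi> \<longrightarrow>
           dhomotopic P \<delta> (A' \<times> B') (NP \<kappa>' \<mu>') ((\<lambda>\<theta>. (\<theta> 0, k (\<theta> z))) \<circ> s \<circ> \<phi>) \<phi>))"
  proof (intro exI[of _ Y] conjI allI impI)
    show "A' \<times> B' = (\<Union>j\<le>q. Y j)"
      using dcontinuous_in[OF r] cover by (auto simp: Y_def)
  next
    fix j assume j: "j \<le> q"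
    then obtain z s where s: "dcontinuous (X j) (NP \<kappa> \<mu>) (path_space A \<kappa> z) (path_adj \<kappa> z) s"
      and lift: "\<And>P \<delta> \<phi>. digital_complex m P \<delta> \<Longrightarrow> dcontinuous P \<delta> (X j) (NP \<kappa> \<mu>) \<phi> \<Longrightarrow>
        dhomotopic P \<delta> (A \<times> B) (NP \<kappa> \<mu>) ((\<lambda>\<theta>. (\<theta> 0, h (\<theta> z))) \<circ> s \<circ> \<phi>) \<phi>"
      using sec by blast
    \<comment> \<open>The path chosen by \<open>s\<close> is moved into \<open>A'\<close> by
      \<alpha>' and keeps its length \<open>z\<close>.\<close>
    define s' where "s' = (\<lambda>\<theta>. restrict (\<alpha>' \<circ> \<theta>) {0..z}) \<circ> (s \<circ> r)"
    have rj: "dcontinuous (Y j) (NP \<kappa>' \<mu>') (X j) (NP \<kappa> \<mu>) r"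
      using r by (rule dcontinuous_subset) (auto simp: Y_def)
    show "\<exists>z s. dcontinuous (Y j) (NP \<kappa>' \<mu>') (path_space A' \<kappa>' z) (path_adj \<kappa>' z) s \<and>
        (\<forall>P \<delta> \<phi>. digital_complex m P \<delta> \<and> dcontinuous P \<delta> (Y j) (NP \<kappa>' \<mu>') \<phi> \<longrightarrow>
           dhomotopic P \<delta> (A' \<times> B') (NP \<kappa>' \<mu>') ((\<lambda>\<theta>. (\<theta> 0, k (\<theta> z))) \<circ> s \<circ> \<phi>) \<phi>)"
    proof (intro exI[of _ z] exI[of _ s'] conjI allI impI)
      show "dcontinuous (Y j) (NP \<kappa>' \<mu>') (path_space A' \<kappa>' z) (path_adj \<kappa>' z) s'"
        unfolding s'_def
        by (rule dcontinuous_comp[OF dcontinuous_comp[OF rj s] dcontinuous_path_map[OF \<alpha>']])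
    next
      fix P \<delta> \<phi>
      assume "digital_complex m P \<delta> \<and> dcontinuous P \<delta> (Y j) (NP \<kappa>' \<mu>') \<phi>"
      then have P: "digital_complex m P \<delta>" and \<phi>: "dcontinuous P \<delta> (Y j) (NP \<kappa>' \<mu>') \<phi>"
        by auto
      have \<phi>': "dcontinuous P \<delta> (A' \<times> B') (NP \<kappa>' \<mu>') \<phi>"
        using \<phi> by (rule dcontinuous_subset) (use dcontinuous_in[OF \<phi>] in \<open>simp_all add: Y_def image_subset_iff\<close>)
      define \<sigma> where "\<sigma> = s \<circ> (r \<circ> \<phi>)"
      have r\<phi>: "dcontinuous P \<delta> (X j) (NP \<kappa> \<mu>) (r \<circ> \<phi>)"
        by (rule dcontinuous_comp[OF \<phi> rj])
      then have \<sigma>: "dcontinuous P \<delta> (path_space A \<kappa> z) (path_adj \<kappa> z) \<sigma>"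
        unfolding \<sigma>_def by (rule dcontinuous_comp[OF _ s])
      have \<sigma>0: "dcontinuous P \<delta> A \<kappa> (\<lambda>p. \<sigma> p 0)" and \<sigma>z: "dcontinuous P \<delta> A \<kappa> (\<lambda>p. \<sigma> p z)"
        using dcontinuous_comp[OF \<sigma> dcontinuous_path_eval] by (auto simp: o_def)
      \<comment> \<open>The final endpoint is freed of \<open>k\<close> and \<alpha>':
        \<open>k\<close> is replaced by \<beta> after \<open>h\<close> after \<alpha>, and then
        \<alpha> after \<alpha>' is cancelled.\<close>
      have "dhomotopic P \<delta> B' \<mu>' (\<lambda>p. k (\<alpha>' (\<sigma> p z))) (\<lambda>p. \<beta> (h (\<alpha> (\<alpha>' (\<sigma> p z)))))"
        using dhomotopic_sym[OF dhomotopic_comp_right[OF k dcontinuous_comp[OF \<sigma>z \<alpha>']]]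
        by (simp add: o_def)
      also have "dhomotopic P \<delta> B' \<mu>' (\<lambda>p. \<beta> (h (\<alpha> (\<alpha>' (\<sigma> p z))))) (\<lambda>p. \<beta> (h (\<sigma> p z)))"
        using dhomotopic_comp_left[OF dhomotopic_comp_right[OF \<alpha>\<alpha>' \<sigma>z] dcontinuous_comp[OF h \<beta>]]
        by (simp add: o_def)
      finally have endpt:
        "dhomotopic P \<delta> B' \<mu>' (\<lambda>p. k (\<alpha>' (\<sigma> p z))) (\<lambda>p. \<beta> (h (\<sigma> p z)))" .
      have "dhomotopic P \<delta> (A' \<times> B') (NP \<kappa>' \<mu>')
          (\<lambda>p. (\<alpha>' (\<sigma> p 0), k (\<alpha>' (\<sigma> p z)))) (\<lambda>p. (\<alpha>' (\<sigma> p 0), \<beta> (h (\<sigma> p z))))"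
        using dhomotopic_Pair[OF dhomotopic_refl[OF dcontinuous_comp[OF \<sigma>0 \<alpha>']] endpt]
        by (simp add: o_def)
      \<comment> \<open>The pair is now the image under \<open>map_prod \<alpha>' \<beta>\<close> of
        the endpoints of \<sigma>, so the defining homotopy of \<open>s\<close> at
        \<open>r \<circ> \<phi>\<close> can be pushed forward.\<close>
      also have "dhomotopic P \<delta> (A' \<times> B') (NP \<kappa>' \<mu>')
          (\<lambda>p. (\<alpha>' (\<sigma> p 0), \<beta> (h (\<sigma> p z)))) (\<lambda>p. map_prod \<alpha>' \<beta> (r (\<phi> p)))"
        using dhomotopic_comp_left[OF lift[OF P r\<phi>] dcontinuous_map_prod[OF \<alpha>' \<beta>]]
        by (simp add: o_def \<sigma>_def)
      \<comment> \<open>By the choice of \<open>r\<close>, the coordinates are \<alpha>' after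
        \<alpha> and \<beta> after \<beta>', applied to those of \<phi>; both are homotopic to
        identities.\<close>
      also have "dhomotopic P \<delta> (A' \<times> B') (NP \<kappa>' \<mu>') (\<lambda>p. map_prod \<alpha>' \<beta> (r (\<phi> p))) \<phi>"
        using dhomotopic_Pair[OF
            dhomotopic_comp_right[OF \<alpha>'\<alpha> dcontinuous_comp[OF \<phi>' dcontinuous_fst]]
            dhomotopic_comp_right[OF \<beta>\<beta>' dcontinuous_comp[OF \<phi>' dcontinuous_snd]]]
        by (simp add: o_def r_def map_prod_def case_prod_beta)
      finally show "dhomotopic P \<delta> (A' \<times> B') (NP \<kappa>' \<mu>')
          ((\<lambda>\<theta>. (\<theta> 0, k (\<theta> z))) \<circ> s' \<circ> \<phi>) \<phi>"
        by (simp add: o_def s'_def \<sigma>_def)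
    qed
  qed
qed

text \<open>Each homotopy between consecutive maps \<open>h i\<close> and \<open>h (Suc i)\<close>
  is transported through \<alpha> and \<beta>, and both of its ends are then corrected to
  \<open>k i\<close> and \<open>k (Suc i)\<close>.\<close>

lemma ddist_le:
  assumes \<alpha>: "dcontinuous D \<kappa>' C \<kappa> \<alpha>" and \<beta>: "dcontinuous C' \<mu> D' \<mu>' \<beta>"
    and k: "\<And>i. i \<in> {1..n} \<Longrightarrow> dhomotopic D \<kappa>' D' \<mu>' (\<beta> \<circ> h i \<circ> \<alpha>) (k i)"
  shows "ddist m D \<kappa>' D' \<mu>' n k \<le> ddist m C \<kappa> C' \<mu> n h"
  unfolding ddist_def
proof (rule least_or_infinity_mono, elim exE conjE)
  fix q :: nat and X
  assume cover: "C = (\<Union>j\<le>q. X j)"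
    and hom: "\<forall>j\<le>q. \<forall>P \<delta> \<phi>. digital_complex m P \<delta> \<and> dcontinuous P \<delta> (X j) \<kappa> \<phi> \<longrightarrow>
      (\<forall>i\<in>{1..<n}. dhomotopic P \<delta> C' \<mu> (h i \<circ> \<phi>) (h (Suc i) \<circ> \<phi>))"
  define Y where "Y j = {a \<in> D. \<alpha> a \<in> X j}" for j
  show "\<exists>Y. D = (\<Union>j\<le>q. Y j) \<and> (\<forall>j\<le>q. \<forall>P \<delta> \<phi>.
      digital_complex m P \<delta> \<and> dcontinuous P \<delta> (Y j) \<kappa>' \<phi> \<longrightarrow>
      (\<forall>i\<in>{1..<n}. dhomotopic P \<delta> D' \<mu>' (k i \<circ> \<phi>) (k (Suc i) \<circ> \<phi>)))"
  proof (intro exI[of _ Y] conjI allI impI ballI)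
    show "D = (\<Union>j\<le>q. Y j)"
      using dcontinuous_in[OF \<alpha>] cover by (auto simp: Y_def)
  next
    fix j P \<delta> \<phi> i
    assume j: "j \<le> q" and i: "i \<in> {1..<n}"
      and "digital_complex m P \<delta> \<and> dcontinuous P \<delta> (Y j) \<kappa>' \<phi>"
    then have P: "digital_complex m P \<delta>" and \<phi>: "dcontinuous P \<delta> (Y j) \<kappa>' \<phi>"
      by auto
    have "dcontinuous (Y j) \<kappa>' (X j) \<kappa> \<alpha>"
      using \<alpha> by (rule dcontinuous_subset) (auto simp: Y_def)
    then have "dcontinuous P \<delta> (X j) \<kappa> (\<alpha> \<circ> \<phi>)"
      by (rule dcontinuous_comp[OF \<phi>])
    then have step: "dhomotopic P \<delta> C' \<mu> (h i \<circ> (\<alpha> \<circ> \<phi>)) (h (Suc i) \<circ> (\<alpha> \<circ> \<phi>))"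
      using hom i j P by blast
    have \<phi>': "dcontinuous P \<delta> D \<kappa>' \<phi>"
      using \<phi> by (rule dcontinuous_subset) (use dcontinuous_in[OF \<phi>] in \<open>simp_all add: Y_def image_subset_iff\<close>)
    have "dhomotopic P \<delta> D' \<mu>' (k i \<circ> \<phi>) (\<beta> \<circ> h i \<circ> \<alpha> \<circ> \<phi>)"
      using i by (intro dhomotopic_sym[OF dhomotopic_comp_right[OF k \<phi>']]) auto
    also have "dhomotopic P \<delta> D' \<mu>' (\<beta> \<circ> h i \<circ> \<alpha> \<circ> \<phi>) (\<beta> \<circ> h (Suc i) \<circ> \<alpha> \<circ> \<phi>)"
      using dhomotopic_comp_left[OF step \<beta>] by (simp add: o_assoc)
    \<comment> \<open>From \<open>i < n\<close> it follows that \<open>Suc i\<close> still lies in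
      \<open>{1..n}\<close>, where the assumed homotopies are available.\<close>
    also have "dhomotopic P \<delta> D' \<mu>' (\<beta> \<circ> h (Suc i) \<circ> \<alpha> \<circ> \<phi>) (k (Suc i) \<circ> \<phi>)"
      using i by (intro dhomotopic_comp_right[OF k \<phi>']) auto
    finally show "dhomotopic P \<delta> D' \<mu>' (k i \<circ> \<phi>) (k (Suc i) \<circ> \<phi>)" .
  qed
qed

section \<open>Powers and higher topological complexity\<close>

lemma dcontinuous_power_map:
  assumes "dcontinuous A \<kappa> B \<mu> f"
  shows "dcontinuous ({1..n} \<rightarrow>\<^sub>E A) (NP_power n \<kappa>) ({1..n} \<rightarrow>\<^sub>E B) (NP_power n \<mu>)
    (\<lambda>x. restrict (f \<circ> x) {1..n})"
proof (rule dcontinuousI)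
  fix x assume "x \<in> {1..n} \<rightarrow>\<^sub>E A"
  then show "restrict (f \<circ> x) {1..n} \<in> {1..n} \<rightarrow>\<^sub>E B"
    using dcontinuous_in[OF assms] by (simp add: PiE_iff)
next
  fix x y assume "x \<in> {1..n} \<rightarrow>\<^sub>E A" "y \<in> {1..n} \<rightarrow>\<^sub>E A" "NP_power n \<kappa> x y"
  then have "\<forall>i\<in>{1..n}. f (x i) = f (y i) \<or> \<mu> (f (x i)) (f (y i))"
    using dcontinuous_adj[OF assms] by (simp add: NP_power_def PiE_iff)
  then show "restrict (f \<circ> x) {1..n} = restrict (f \<circ> y) {1..n} \<or>
      NP_power n \<mu> (restrict (f \<circ> x) {1..n}) (restrict (f \<circ> y) {1..n})"
    by (simp add: NP_power_def)
qed

lemma dcontinuous_power_proj: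
  "i \<in> {1..n} \<Longrightarrow> dcontinuous ({1..n} \<rightarrow>\<^sub>E A) (NP_power n \<kappa>) A \<kappa> (\<lambda>x. x i)"
  by (auto simp: dcontinuous_def NP_power_def)

text \<open>Pulling tuples back by \<open>g\<close> in each coordinate commutes with the
  projections, so \<open>ddist_le\<close> applies with \<beta> taken to be \<open>f\<close>: each
  projection becomes \<open>f \<circ> g\<close> after itself, which is homotopic to it.\<close>

lemma higher_TC_le:
  assumes f: "dcontinuous A \<kappa> A' \<kappa>' f" and g: "dcontinuous A' \<kappa>' A \<kappa> g"
    and fg: "dhomotopic A' \<kappa>' A' \<kappa>' (f \<circ> g) id"
  shows "higher_TC n m A' \<kappa>' \<le> higher_TC n m A \<kappa>"
  unfolding higher_TC_def
proof (rule ddist_le[OF dcontinuous_power_map[OF g] f])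
  fix i assume i: "i \<in> {1..n}"
  then have "f \<circ> (\<lambda>x. x i) \<circ> (\<lambda>x. restrict (g \<circ> x) {1..n}) = f \<circ> g \<circ> (\<lambda>x. x i)"
    by (auto simp: fun_eq_iff)
  then show "dhomotopic ({1..n} \<rightarrow>\<^sub>E A') (NP_power n \<kappa>') A' \<kappa>'
      (f \<circ> (\<lambda>x. x i) \<circ> (\<lambda>x. restrict (g \<circ> x) {1..n})) (\<lambda>x. x i)"
    using dhomotopic_comp_right[OF fg dcontinuous_power_proj[OF i]] by simp
qed

section \<open>Homotopy invariance\<close>

lemma TC_eq_TC_map: "TC m A \<kappa> = TC_map m A \<kappa> A \<kappa> id"
  by (simp add: TC_def TC_map_def)

lemma dhomotopy_equivalenceE:
  assumes "dhomotopy_equivalence A \<kappa> B \<mu> f"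
  obtains g where "dcontinuous A \<kappa> B \<mu> f" "dcontinuous B \<mu> A \<kappa> g"
    "dhomotopic B \<mu> B \<mu> (f \<circ> g) id" "dhomotopic A \<kappa> A \<kappa> (g \<circ> f) id"
  using assms unfolding dhomotopy_equivalence_def by blast

text \<open>This makes the relation between \<open>h\<close> and \<open>k\<close> symmetric: after
  \<open>k\<close> is replaced by \<beta> after \<open>h\<close> after \<alpha>, the composites of
  \<beta>' with \<beta> and of \<alpha> with \<alpha>' cancel up to homotopy.\<close>

lemma dhomotopic_transpose:
  assumes \<alpha>': "dcontinuous A \<kappa> A' \<kappa>' \<alpha>'" and \<alpha>\<alpha>': "dhomotopic A \<kappa> A \<kappa> (\<alpha> \<circ> \<alpha>') id"
    and \<beta>': "dcontinuous B' \<mu>' B \<mu> \<beta>'" and \<beta>'\<beta>: "dhomotopic B \<mu> B \<mu> (\<beta>' \<circ> \<beta>) id"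
    and h: "dcontinuous A \<kappa> B \<mu> h"
    and k: "dhomotopic A' \<kappa>' B' \<mu>' (\<beta> \<circ> h \<circ> \<alpha>) k"
  shows "dhomotopic A \<kappa> B \<mu> (\<beta>' \<circ> k \<circ> \<alpha>') h"
proof -
  have "dhomotopic A \<kappa> B \<mu> (\<beta>' \<circ> k \<circ> \<alpha>') (\<beta>' \<circ> (\<beta> \<circ> h \<circ> \<alpha>) \<circ> \<alpha>')"
    by (rule dhomotopic_sym[OF dhomotopic_comp_right[OF dhomotopic_comp_left[OF k \<beta>'] \<alpha>']])
  also have "dhomotopic A \<kappa> B \<mu> (\<beta>' \<circ> (\<beta> \<circ> h \<circ> \<alpha>) \<circ> \<alpha>') (h \<circ> (\<alpha> \<circ> \<alpha>'))"
    \<comment> \<open>Continuity of \<open>h \<circ> (\<alpha> \<circ> \<alpha>')\<close> is read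
      off from its homotopy to \<open>h\<close>.\<close>
    using dhomotopic_comp_right[OF \<beta>'\<beta> dhomotopic_imp_dcontinuous(1)[OF dhomotopic_comp_left[OF \<alpha>\<alpha>' h]]]
    by (simp add: o_assoc)
  also have "dhomotopic A \<kappa> B \<mu> (h \<circ> (\<alpha> \<circ> \<alpha>')) h"
    using dhomotopic_comp_left[OF \<alpha>\<alpha>' h] by simp
  finally show ?thesis .
qed

lemma invariance_of_maps:
  assumes h: "dcontinuous A \<kappa> B \<mu> h" and k: "dcontinuous A' \<kappa>' B' \<mu>' k"
    and \<omega>1: "dhomotopy_equivalence B \<mu> B' \<mu>' \<omega>1" and \<omega>2: "dhomotopy_equivalence A' \<kappa>' A \<kappa> \<omega>2"
    and hk: "dhomotopic A' \<kappa>' B' \<mu>' (\<omega>1 \<circ> h \<circ> \<omega>2) k"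
  shows cat_map_homotopy_invariant: "cat_map m A \<kappa> B \<mu> h = cat_map m A' \<kappa>' B' \<mu>' k"
    and TC_map_homotopy_invariant: "TC_map m A \<kappa> B \<mu> h = TC_map m A' \<kappa>' B' \<mu>' k"
proof -
  obtain \<rho>1 where 1: "dcontinuous B \<mu> B' \<mu>' \<omega>1" "dcontinuous B' \<mu>' B \<mu> \<rho>1"
    "dhomotopic B' \<mu>' B' \<mu>' (\<omega>1 \<circ> \<rho>1) id" "dhomotopic B \<mu> B \<mu> (\<rho>1 \<circ> \<omega>1) id"
    using \<omega>1 by (rule dhomotopy_equivalenceE)
  obtain \<rho>2 where 2: "dcontinuous A' \<kappa>' A \<kappa> \<omega>2" "dcontinuous A \<kappa> A' \<kappa>' \<rho>2"
    "dhomotopic A \<kappa> A \<kappa> (\<omega>2 \<circ> \<rho>2) id" "dhomotopic A' \<kappa>' A' \<kappa>' (\<rho>2 \<circ> \<omega>2) id"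
    using \<omega>2 by (rule dhomotopy_equivalenceE)
  have kh: "dhomotopic A \<kappa> B \<mu> (\<rho>1 \<circ> k \<circ> \<rho>2) h"
    by (rule dhomotopic_transpose[OF 2(2,3) 1(2,4) h hk])
  show "cat_map m A \<kappa> B \<mu> h = cat_map m A' \<kappa>' B' \<mu>' k"
    by (rule antisym[OF cat_map_le[OF 2(2) 1(2) kh] cat_map_le[OF 2(1) 1(1) hk]])
  show "TC_map m A \<kappa> B \<mu> h = TC_map m A' \<kappa>' B' \<mu>' k"
    \<comment> \<open>The permuted facts exchange each \<omega> with its inverse \<rho>, which gives
      the inequality in the other direction.\<close>
    by (rule antisym[OF TC_map_le[OF 2(2,1,4,3) 1(2,1,4) k kh] TC_map_le[OF 2(1-4) 1(1-3) h hk]])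
qed

text \<open>For \<open>cat\<close> and \<open>TC\<close> this is the invariance for maps with both
  maps the identity, \<omega>1 being \<open>f\<close> and \<omega>2, which runs from
  \<open>A'\<close> to \<open>A\<close>, being its inverse \<open>g\<close>. For
  \<open>higher_TC\<close> the inequality is applied in both directions.\<close>

lemma invariance_of_images:
  assumes "dhomotopy_equivalence A \<kappa> A' \<kappa>' f"
  shows cat_homotopy_invariant: "cat m A \<kappa> = cat m A' \<kappa>'"
    and TC_homotopy_invariant: "TC m A \<kappa> = TC m A' \<kappa>'"
    and higher_TC_homotopy_invariant: "higher_TC n m A \<kappa> = higher_TC n m A' \<kappa>'"
proof -
  obtain g where fg: "dcontinuous A \<kappa> A' \<kappa>' f" "dcontinuous A' \<kappa>' A \<kappa> g"
    "dhomotopic A' \<kappa>' A' \<kappa>' (f \<circ> g) id" "dhomotopic A \<kappa> A \<kappa> (g \<circ> f) id"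
    using assms by (rule dhomotopy_equivalenceE)
  then have g: "dhomotopy_equivalence A' \<kappa>' A \<kappa> g"
    unfolding dhomotopy_equivalence_def by blast
  have id: "dhomotopic A' \<kappa>' A' \<kappa>' (f \<circ> id \<circ> g) id"
    using fg(3) by simp
  note maps = dcontinuous_id dcontinuous_id assms g id
  show "cat m A \<kappa> = cat m A' \<kappa>'"
    unfolding cat_def by (rule cat_map_homotopy_invariant[OF maps])
  show "TC m A \<kappa> = TC m A' \<kappa>'"
    unfolding TC_eq_TC_map by (rule TC_map_homotopy_invariant[OF maps])
  show "higher_TC n m A \<kappa> = higher_TC n m A' \<kappa>'"
    by (rule antisym[OF higher_TC_le[OF fg(2,1,4)] higher_TC_le[OF fg(1-3)]])
qed

theorem corollary4p12:
  fixes m n :: nat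
  assumes "m \<ge> 1" and "n > 1"
  shows
    "(\<forall>A \<kappa> A' \<kappa>'.
        digital_image A \<kappa> \<and> digital_image A' \<kappa>' \<and> dconnected A \<kappa> \<and> dconnected A' \<kappa>' \<and>
        (\<exists>f. dhomotopy_equivalence A \<kappa> A' \<kappa>' f) \<longrightarrow>
        cat m A \<kappa> = cat m A' \<kappa>' \<and> TC m A \<kappa> = TC m A' \<kappa>' \<and>
        higher_TC n m A \<kappa> = higher_TC n m A' \<kappa>')
     \<and>
     (\<forall>A \<kappa> B \<mu> A' \<kappa>' B' \<mu>' h k \<omega>1 \<omega>2.
        digital_image A \<kappa> \<and> digital_image B \<mu> \<and> digital_image A' \<kappa>' \<and> digital_image B' \<mu>' \<and>
        dcontinuous A \<kappa> B \<mu> h \<and> dcontinuous A' \<kappa>' B' \<mu>' k \<and>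
        dhomotopy_equivalence B \<mu> B' \<mu>' \<omega>1 \<and> dhomotopy_equivalence A' \<kappa>' A \<kappa> \<omega>2 \<and>
        dhomotopic A' \<kappa>' B' \<mu>' (\<omega>1 \<circ> h \<circ> \<omega>2) k \<longrightarrow>
        cat_map m A \<kappa> B \<mu> h = cat_map m A' \<kappa>' B' \<mu>' k \<and>
        (dfibration A \<kappa> B \<mu> h \<and> dfibration A' \<kappa>' B' \<mu>' k \<longrightarrow>
           TC_map m A \<kappa> B \<mu> h = TC_map m A' \<kappa>' B' \<mu>' k))"
proof (rule conjI; intro allI impI)
  fix A \<kappa> A' \<kappa>'
  assume "digital_image A \<kappa> \<and> digital_image A' \<kappa>' \<and> dconnected A \<kappa> \<and> dconnected A' \<kappa>' \<and>
    (\<exists>f. dhomotopy_equivalence A \<kappa> A' \<kappa>' f)"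
  then obtain f where f: "dhomotopy_equivalence A \<kappa> A' \<kappa>' f"
    by blast
  show "cat m A \<kappa> = cat m A' \<kappa>' \<and> TC m A \<kappa> = TC m A' \<kappa>' \<and>
      higher_TC n m A \<kappa> = higher_TC n m A' \<kappa>'"
    by (intro conjI cat_homotopy_invariant[OF f] TC_homotopy_invariant[OF f]
        higher_TC_homotopy_invariant[OF f])
next
  fix A \<kappa> B \<mu> A' \<kappa>' B' \<mu>' h k \<omega>1 \<omega>2
  assume "digital_image A \<kappa> \<and> digital_image B \<mu> \<and> digital_image A' \<kappa>' \<and> digital_image B' \<mu>' \<and>
    dcontinuous A \<kappa> B \<mu> h \<and> dcontinuous A' \<kappa>' B' \<mu>' k \<and>
    dhomotopy_equivalence B \<mu> B' \<mu>' \<omega>1 \<and> dhomotopy_equivalence A' \<kappa>' A \<kappa> \<omega>2 \<and>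
    dhomotopic A' \<kappa>' B' \<mu>' (\<omega>1 \<circ> h \<circ> \<omega>2) k"
  then have h: "dcontinuous A \<kappa> B \<mu> h" and k: "dcontinuous A' \<kappa>' B' \<mu>' k"
    and \<omega>1: "dhomotopy_equivalence B \<mu> B' \<mu>' \<omega>1" and \<omega>2: "dhomotopy_equivalence A' \<kappa>' A \<kappa> \<omega>2"
    and hk: "dhomotopic A' \<kappa>' B' \<mu>' (\<omega>1 \<circ> h \<circ> \<omega>2) k"
    by simp_all
  show "cat_map m A \<kappa> B \<mu> h = cat_map m A' \<kappa>' B' \<mu>' k \<and>
      (dfibration A \<kappa> B \<mu> h \<and> dfibration A' \<kappa>' B' \<mu>' k \<longrightarrow>
        TC_map m A \<kappa> B \<mu> h = TC_map m A' \<kappa>' B' \<mu>' k)"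
    by (intro conjI impI cat_map_homotopy_invariant[OF h k \<omega>1 \<omega>2 hk]
        TC_map_homotopy_invariant[OF h k \<omega>1 \<omega>2 hk])
qed

end
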